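(* Let $H$ be a target graph, possibly with loops, for which there is an ordering $H^1,\ldots,H^k$ of the automorphic similarity classes such that the associated automorphic similarity matrix has the increasing columns property. Suppose that for each $t\ge 2$ there exist two classes $H^{a(t)}$ and $H^{b(t)}$ such that there is at least one $H$-coloring of $P_t$ that sends one endvertex of $P_t$ to a vertex in $H^{a(t)}$ and the other endvertex to a vertex in $H^{b(t)}$. Suppose further that (for each $t\ge 2$) for all $s\ge 2$ it holds that $\hom_{v\to b(t)}(P_s,H)>\hom_{v\to a(t)}(P_s,H)$, where $v$ is one of the endvertices of $P_s$. Then $H$ is strongly Hoffman-London.
   Context: All graphs are finite. A target graph $H$ is a graph without multiple edges but possibly with loops. For a simple loopless graph $G$, an $H$-coloring of $G$ is a map $f:V(G)\to V(H)$ such that $f(u)\sim_H f(v)$ whenever $u\sim_G v$; $\hom(G,H)$ denotes the number of $H$-colorings of $G$. $\mathcal{T}_n$ is the set of all trees on $n$ vertices (up to isomorphism) and $P_n\in\mathcal{T}_n$ is the path on $n$ vertices. $H$ is strongly Hoffman-London if $\hom(P_n,H)<\hom(T_n,H)$ for all $n\ge 1$ and all $T_n\in\mathcal{T}_n\setminus\{P_n\}$. Vertices $u,v$ of $H$ are automorphically similar if some automorphism of $H$ maps $u$ to $v$; the equivalence classes of this relation are the automorphic similarity classes $H^1,\ldots,H^k$. For all $i,j$ every vertex of $H^i$ has the same number $m_{i,j}$ of neighbors in $H^j$ (a looped vertex is a neighbor of itself, counted once). The automorphic similarity matrix of $H$ relative to the ordering $H^1,\ldots,H^k$ is the $k\times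 k$ matrix with $(i,j)$-entry $m_{i,j}$. A $k\times k$ matrix $(m_{i,j})$ has the increasing columns property if for each $1\le c\le k$ and each $1\le i\le k-1$, $\sum_{j=c}^k m_{i,j}\le\sum_{j=c}^k m_{i+1,j}$. For a graph $G$ with designated vertex $v$, $\hom_{v\to i}(G,H)$ denotes the number of $H$-colorings of $G$ in which $v$ is mapped to some (arbitrary but specific) vertex of $H^i$; this number does not depend on the chosen vertex of $H^i$. *)

theory Defs
  imports
    "HOL-Library.FuncSet"
    "Graph_Theory.Digraph_Isomorphism"
    "Graph_Theory.Pair_Digraph"
begin

text \<open>
  Undirected graphs are symmetric relations, as in Graph\_Theory: each edge $uv$ is represented by
  the two arcs $(u,v)$ and $(v,u)$, and a loop at $u$ by the single arc $(u,u)$.  A target graph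
  is a \<^locale>\<open>pair_pseudo_graph\<close> (finite, symmetric, loops allowed); a simple graph is a
  \<^locale>\<open>pair_graph\<close>.
\<close>

section \<open>Colorings\<close>

text \<open>Extensionality makes distinct functions distinct maps on the vertex set, for counting.\<close>

definition colorings :: "'b pair_pre_digraph \<Rightarrow> 'a pair_pre_digraph \<Rightarrow> ('b \<Rightarrow> 'a) set" where
  "colorings G H =
     {f \<in> pverts G \<rightarrow>\<^sub>E pverts H. \<forall>u v. (u, v) \<in> parcs G \<longrightarrow> (f u, f v) \<in> parcs H}"

definition num_colorings :: "'b pair_pre_digraph \<Rightarrow> 'a pair_pre_digraph \<Rightarrow> nat" where
  "num_colorings G H = card (colorings G H)"

section \<open>Trees and paths\<close>

text \<open>
  In Graph\_Theory an edge traversed back and forth is a \<^const>\<open>pre_digraph.cycle\<close> of length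
  two, so that its notion of a tree cannot be used for symmetric digraphs.  The cycles of a simple
  graph are those of length at least three.
\<close>

definition graph_tree :: "'b pair_pre_digraph \<Rightarrow> bool" where
  "graph_tree T \<longleftrightarrow>
     pair_graph T \<and> connected (with_proj T) \<and>
     \<not> (\<exists>p. pre_digraph.cycle (with_proj T) p \<and> 3 \<le> length p)"

definition path_graph :: "nat \<Rightarrow> nat pair_pre_digraph" where
  "path_graph n =
     \<lparr>pverts = {1..n}, parcs = {(i, j). i \<in> {1..n} \<and> j \<in> {1..n} \<and> (j = i + 1 \<or> i = j + 1)}\<rparr>"

text \<open>Every finite tree is isomorphic to one whose vertices are natural numbers.\<close>

definition strongly_Hoffman_London :: "'a pair_pre_digraph \<Rightarrow> bool" where
  "strongly_Hoffman_London H \<longleftrightarrow>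
     (\<forall>n\<ge>1. \<forall>T :: nat pair_pre_digraph.
        graph_tree T \<and> card (pverts T) = n \<and>
        \<not> digraph_iso (with_proj T) (with_proj (path_graph n)) \<longrightarrow>
        num_colorings (path_graph n) H < num_colorings T H)"

section \<open>Automorphic similarity\<close>

definition automorphically_similar :: "'a pair_pre_digraph \<Rightarrow> 'a rel" where
  "automorphically_similar H =
     {(u, v) \<in> pverts H \<times> pverts H.
        \<exists>f. pre_digraph.digraph_isomorphism (with_proj H) f \<and>
            app_iso f (with_proj H) = with_proj H \<and> iso_verts f u = v}"

definition similarity_classes :: "'a pair_pre_digraph \<Rightarrow> 'a set set" where
  "similarity_classes H = pverts H // automorphically_similar H"

text \<open>
  In the next two definitions the vertex chosen from a class is irrelevant: see
  \<open>similarity_matrix_eq\<close> and \<open>num_colorings_to_class_eq\<close> below.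
\<close>

definition similarity_matrix :: "'a pair_pre_digraph \<Rightarrow> (nat \<Rightarrow> 'a set) \<Rightarrow> nat \<Rightarrow> nat \<Rightarrow> nat" where
  "similarity_matrix H C i j = card {w \<in> C j. ((SOME u. u \<in> C i), w) \<in> parcs H}"

definition num_colorings_to_class ::
    "'b pair_pre_digraph \<Rightarrow> 'b \<Rightarrow> 'a pair_pre_digraph \<Rightarrow> 'a set \<Rightarrow> nat" where
  "num_colorings_to_class G v H X = card {f \<in> colorings G H. f v = (SOME x. x \<in> X)}"

definition increasing_columns ::
    "nat \<Rightarrow> (nat \<Rightarrow> nat \<Rightarrow> 'c :: ordered_comm_monoid_add) \<Rightarrow> bool" where
  "increasing_columns k m \<longleftrightarrow>
     (\<forall>c i. 1 \<le> c \<and> c \<le> k \<and> 1 \<le> i \<and> i + 1 \<le> k \<longrightarrow>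
        (\<Sum>j=c..k. m i j) \<le> (\<Sum>j=c..k. m (i + 1) j))"

section \<open>Independence of the chosen vertices\<close>

lemma automorphically_similar_iff:
  assumes "pair_wf_digraph H"
  shows "(u, v) \<in> automorphically_similar H \<longleftrightarrow>
     u \<in> pverts H \<and> v \<in> pverts H \<and>
     (\<exists>g. bij_betw g (pverts H) (pverts H) \<and> map_prod g g ` parcs H = parcs H \<and> g u = v)"
    (is "?L \<longleftrightarrow> ?R")
proof
  interpret pair_wf_digraph H by fact
  assume ?L
  then obtain f where uv: "u \<in> pverts H" "v \<in> pverts H"
    and f: "pre_digraph.digraph_isomorphism (with_proj H) f"
      "app_iso f (with_proj H) = with_proj H" "iso_verts f u = v"
    by (auto simp: automorphically_similar_def)
  have eqs: "iso_verts f ` pverts H = pverts H" "iso_arcs f ` parcs H = parcs H"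
      "iso_tail f = fst" "iso_head f = snd"
    using f(2) by (auto simp: app_iso_def with_proj_def)
  have "iso_arcs f e = map_prod (iso_verts f) (iso_verts f) e" if "e \<in> parcs H" for e
    using f(1) that unfolding digraph_isomorphism_def eqs by (cases e) (auto simp: prod_eq_iff)
  then have "map_prod (iso_verts f) (iso_verts f) ` parcs H = parcs H"
    using eqs(2) by (simp cong: image_cong)
  moreover have "bij_betw (iso_verts f) (pverts H) (pverts H)"
    using f(1) eqs(1) by (auto simp: digraph_isomorphism_def bij_betw_def)
  ultimately show ?R
    using uv f(3) by (intro conjI exI[of _ "iso_verts f"])
next
  interpret pair_wf_digraph H by fact
  assume ?R
  then obtain g where g: "u \<in> pverts H" "v \<in> pverts H" "bij_betw g (pverts H) (pverts H)"
      "map_prod g g ` parcs H = parcs H" "g u = v"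
    by blast
  let ?f = "\<lparr>iso_verts = g, iso_arcs = map_prod g g, iso_head = snd, iso_tail = fst\<rparr>"
  have inj: "inj_on g (pverts H)"
    using g(3) by (auto simp: bij_betw_def)
  have "parcs H \<subseteq> pverts H \<times> pverts H"
    by (auto dest: in_arcsD1 in_arcsD2)
  then have "inj_on (map_prod g g) (parcs H)"
    using map_prod_inj_on[OF inj inj] inj_on_subset by blast
  then have "pre_digraph.digraph_isomorphism (with_proj H) ?f"
    using inj wf_digraph by (simp add: digraph_isomorphism_def)
  moreover have "app_iso ?f (with_proj H) = with_proj H"
    using g(3,4) by (simp add: app_iso_def with_proj_def bij_betw_def)
  ultimately show ?L
    using g(1,2,5) unfolding automorphically_similar_def
    by (auto intro!: exI[of _ ?f])
qed

lemma equiv_automorphically_similar: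
  assumes "pair_wf_digraph H"
  shows "equiv (pverts H) (automorphically_similar H)"
proof (rule equivI)
  show "automorphically_similar H \<subseteq> pverts H \<times> pverts H"
    by (auto simp: automorphically_similar_def)
  show "refl_on (pverts H) (automorphically_similar H)"
  proof (rule refl_onI)
    fix x assume "x \<in> pverts H"
    then show "(x, x) \<in> automorphically_similar H"
      unfolding automorphically_similar_iff[OF assms]
      by (intro conjI exI[of _ id]) (auto simp: prod.map_id0)
  qed
  show "sym (automorphically_similar H)"
  proof (rule symI)
    fix x y assume "(x, y) \<in> automorphically_similar H"
    then obtain g where g: "x \<in> pverts H" "y \<in> pverts H" "bij_betw g (pverts H) (pverts H)"
        "map_prod g g ` parcs H = parcs H" "g x = y"
      unfolding automorphically_similar_iff[OF assms] by blast
    let ?h = "inv_into (pverts H) g"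
    interpret pair_wf_digraph H by fact
    have inv: "?h (g z) = z" if "z \<in> pverts H" for z
      using g(3) that by (simp add: bij_betw_inv_into_left)
    have "map_prod ?h ?h ` parcs H = map_prod ?h ?h ` map_prod g g ` parcs H"
      using g(4) by simp
    also have "\<dots> = (\<lambda>e. e) ` parcs H"
      unfolding image_image
      by (intro image_cong) (auto simp: inv in_arcsD1 in_arcsD2)
    finally have "map_prod ?h ?h ` parcs H = parcs H"
      by simp
    then show "(y, x) \<in> automorphically_similar H"
      unfolding automorphically_similar_iff[OF assms]
      using g(1,2,5) inv[OF g(1)] bij_betw_inv_into[OF g(3)]
      by (intro conjI exI[of _ ?h]) simp_all
  qed
  show "trans (automorphically_similar H)"
  proof (rule transI)
    fix x y z assume "(x, y) \<in> automorphically_similar H" "(y, z) \<in> automorphically_similar H"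
    then obtain g h where xz: "x \<in> pverts H" "z \<in> pverts H"
        and gh: "bij_betw g (pverts H) (pverts H)" "map_prod g g ` parcs H = parcs H" "g x = y"
        "bij_betw h (pverts H) (pverts H)" "map_prod h h ` parcs H = parcs H" "h y = z"
      unfolding automorphically_similar_iff[OF assms] by blast
    have "map_prod (h \<circ> g) (h \<circ> g) ` parcs H = map_prod h h ` map_prod g g ` parcs H"
      unfolding map_prod.comp[symmetric] image_comp ..
    then have "map_prod (h \<circ> g) (h \<circ> g) ` parcs H = parcs H"
      using gh by simp
    moreover have "bij_betw (h \<circ> g) (pverts H) (pverts H)"
      using gh by (intro bij_betw_trans)
    ultimately show "(x, z) \<in> automorphically_similar H"
      unfolding automorphically_similar_iff[OF assms]
      using xz gh by (intro conjI exI[of _ "h \<circ> g"]) simp_all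
  qed
qed

lemma similarity_class_automorphism:
  assumes H: "pair_wf_digraph H" and X: "X \<in> similarity_classes H" and "u \<in> X" "v \<in> X"
  shows "\<exists>g. bij_betw g (pverts H) (pverts H) \<and> g u = v \<and>
    (\<forall>x\<in>pverts H. \<forall>y\<in>pverts H. (g x, g y) \<in> parcs H \<longleftrightarrow> (x, y) \<in> parcs H) \<and>
    (\<forall>Y\<in>similarity_classes H. \<forall>x\<in>pverts H. g x \<in> Y \<longleftrightarrow> x \<in> Y)"
proof -
  note eq = equiv_automorphically_similar[OF H]
  interpret pair_wf_digraph H by fact
  have "(u, v) \<in> automorphically_similar H"
    using quotient_eq_iff[OF eq] X assms(3,4) by (auto simp: similarity_classes_def)
  then obtain g where g: "bij_betw g (pverts H) (pverts H)" "map_prod g g ` parcs H = parcs H"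
      "g u = v"
    unfolding automorphically_similar_iff[OF H] by blast
  have inj: "inj_on g (pverts H)" and gv: "\<And>x. x \<in> pverts H \<Longrightarrow> g x \<in> pverts H"
    using g(1) by (auto simp: bij_betw_def)
  have arcs: "(g x, g y) \<in> parcs H \<longleftrightarrow> (x, y) \<in> parcs H" if "x \<in> pverts H" "y \<in> pverts H" for x y
  proof
    assume "(g x, g y) \<in> parcs H"
    then have "(g x, g y) \<in> map_prod g g ` parcs H"
      using g(2) by simp
    then obtain x' y' where xy: "(x', y') \<in> parcs H" "g x = g x'" "g y = g y'"
      by auto
    have "x = x'" "y = y'"
      using inj_onD[OF inj xy(2)] inj_onD[OF inj xy(3)] that in_arcsD1[OF xy(1)] in_arcsD2[OF xy(1)]
      by auto
    then show "(x, y) \<in> parcs H"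
      using xy(1) by simp
  next
    assume "(x, y) \<in> parcs H"
    then have "map_prod g g (x, y) \<in> parcs H"
      using g(2) by blast
    then show "(g x, g y) \<in> parcs H"
      by simp
  qed
  have cls: "g x \<in> Y \<longleftrightarrow> x \<in> Y" if "Y \<in> similarity_classes H" "x \<in> pverts H" for Y x
  proof -
    have xg: "(x, g x) \<in> automorphically_similar H"
      unfolding automorphically_similar_iff[OF H]
      using g that gv by (intro conjI exI[of _ g]) simp_all
    then have "(g x, x) \<in> automorphically_similar H"
      using eq unfolding equiv_def by (blast dest: symD)
    with xg show ?thesis
      using in_quotient_imp_closed[OF eq] that unfolding similarity_classes_def by blast
  qed
  show ?thesis
    using g(1,3) arcs cls by (intro exI[of _ g] conjI ballI)
qed

lemma similarity_class_subset:
  "pair_wf_digraph H \<Longrightarrow> X \<in> similarity_classes H \<Longrightarrow> X \<subseteq> pverts H"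
  using in_quotient_imp_subset[OF equiv_automorphically_similar] by (auto simp: similarity_classes_def)

lemma similarity_matrix_eq:
  assumes H: "pair_wf_digraph H" and C: "C i \<in> similarity_classes H" "C j \<in> similarity_classes H"
    and u: "u \<in> C i"
  shows "similarity_matrix H C i j = card {w \<in> C j. (u, w) \<in> parcs H}"
proof -
  define v where "v = (SOME u. u \<in> C i)"
  have v: "v \<in> C i"
    using u unfolding v_def by (rule someI)
  obtain g where g: "bij_betw g (pverts H) (pverts H)" "g u = v"
    "\<forall>x\<in>pverts H. \<forall>y\<in>pverts H. (g x, g y) \<in> parcs H \<longleftrightarrow> (x, y) \<in> parcs H"
    "\<forall>Y\<in>similarity_classes H. \<forall>x\<in>pverts H. g x \<in> Y \<longleftrightarrow> x \<in> Y"
    using similarity_class_automorphism[OF H C(1) u v] by (elim exE conjE)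
  have sub: "C i \<subseteq> pverts H" "C j \<subseteq> pverts H"
    using similarity_class_subset[OF H] C by auto
  then have uV: "u \<in> pverts H"
    using u by blast
  have "bij_betw g {w \<in> C j. (u, w) \<in> parcs H} {w \<in> C j. (v, w) \<in> parcs H}"
  proof (rule bij_betw_imageI)
    show "inj_on g {w \<in> C j. (u, w) \<in> parcs H}"
      using g(1) sub(2) unfolding bij_betw_def by (blast intro: inj_on_subset)
    show "g ` {w \<in> C j. (u, w) \<in> parcs H} = {w \<in> C j. (v, w) \<in> parcs H}"
    proof (intro equalityI subsetI)
      fix w assume "w \<in> g ` {w \<in> C j. (u, w) \<in> parcs H}"
      then obtain w' where w': "w' \<in> C j" "(u, w') \<in> parcs H" "w = g w'"
        by blast
      have "w' \<in> pverts H"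
        using w' sub by blast
      then show "w \<in> {w \<in> C j. (v, w) \<in> parcs H}"
        using w' g(2) g(3)[rule_format, OF uV, of w'] g(4)[rule_format, OF C(2), of w'] by simp
    next
      fix w assume w: "w \<in> {w \<in> C j. (v, w) \<in> parcs H}"
      then have "w \<in> g ` pverts H"
        using sub g(1) by (auto simp: bij_betw_def)
      then obtain w' where w': "w' \<in> pverts H" "w = g w'"
        by blast
      then have "w' \<in> {w \<in> C j. (u, w) \<in> parcs H}"
        using w g(2) g(3)[rule_format, OF uV, of w'] g(4)[rule_format, OF C(2), of w'] by simp
      then show "w \<in> g ` {w \<in> C j. (u, w) \<in> parcs H}"
        using w' by blast
    qed
  qed
  then show ?thesis
    by (simp add: similarity_matrix_def v_def bij_betw_same_card)
qed

lemma num_colorings_to_class_eq: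
  assumes G: "pair_wf_digraph G" and H: "pair_wf_digraph H"
    and X: "X \<in> similarity_classes H" and x: "x \<in> X" and v: "v \<in> pverts G"
  shows "num_colorings_to_class G v H X = card {f \<in> colorings G H. f v = x}"
proof -
  have inj: "\<exists>F. inj_on F {f \<in> colorings G H. f v = y} \<and>
      F ` {f \<in> colorings G H. f v = y} \<subseteq> {f \<in> colorings G H. f v = z}"
    if yz: "y \<in> X" "z \<in> X" for y z
  proof -
    obtain g where g: "bij_betw g (pverts H) (pverts H)" "g y = z"
      "\<forall>x\<in>pverts H. \<forall>y\<in>pverts H. (g x, g y) \<in> parcs H \<longleftrightarrow> (x, y) \<in> parcs H"
      "\<forall>Y\<in>similarity_classes H. \<forall>x\<in>pverts H. g x \<in> Y \<longleftrightarrow> x \<in> Y"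
      using similarity_class_automorphism[OF H X yz] by (elim exE conjE)
    let ?F = "\<lambda>f. restrict (g \<circ> f) (pverts G)"
    have "inj_on ?F (colorings G H)"
    proof (rule inj_onI)
      fix f f' assume f: "f \<in> colorings G H" "f' \<in> colorings G H" and eq: "?F f = ?F f'"
      show "f = f'"
      proof (rule PiE_ext)
        show "f \<in> pverts G \<rightarrow>\<^sub>E pverts H" "f' \<in> pverts G \<rightarrow>\<^sub>E pverts H"
          using f by (simp_all add: colorings_def)
        fix w assume w: "w \<in> pverts G"
        then have "g (f w) = g (f' w)"
          using fun_cong[OF eq, of w] by simp
        moreover have "f w \<in> pverts H" "f' w \<in> pverts H"
          using f w by (auto simp: colorings_def)
        ultimately show "f w = f' w"
          using g(1) unfolding bij_betw_def by (blast dest: inj_onD)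
      qed
    qed
    moreover have "?F f \<in> colorings G H" if f: "f \<in> colorings G H" for f
    proof -
      have fv: "f w \<in> pverts H" if "w \<in> pverts G" for w
        using f that by (auto simp: colorings_def)
      have "g (f w) \<in> pverts H" if "w \<in> pverts G" for w
        using g(1) fv[OF that] by (auto simp: bij_betw_def)
      moreover have "(?F f a, ?F f b) \<in> parcs H" if "(a, b) \<in> parcs G" for a b
      proof -
        have "a \<in> pverts G" "b \<in> pverts G"
          using pair_wf_digraph.in_arcsD1[OF G that] pair_wf_digraph.in_arcsD2[OF G that] by auto
        then show ?thesis
          using f that fv g(3) by (simp add: colorings_def)
      qed
      ultimately show ?thesis
        by (auto simp: colorings_def)
    qed
    moreover have "?F f v = z" if "f v = y" for f
      using v g(2) that by simp
    ultimately show ?thesis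
      by (intro exI[of _ ?F] conjI) (erule inj_on_subset, blast, blast)
  qed
  define y where "y = (SOME x. x \<in> X)"
  have y: "y \<in> X"
    using x unfolding y_def by (rule someI)
  obtain F F' where F:
      "inj_on F {f \<in> colorings G H. f v = y}"
      "F ` {f \<in> colorings G H. f v = y} \<subseteq> {f \<in> colorings G H. f v = x}"
      "inj_on F' {f \<in> colorings G H. f v = x}"
      "F' ` {f \<in> colorings G H. f v = x} \<subseteq> {f \<in> colorings G H. f v = y}"
    using inj[OF y x] inj[OF x y] by (elim exE conjE)
  then obtain b where "bij_betw b {f \<in> colorings G H. f v = y} {f \<in> colorings G H. f v = x}"
    using Schroeder_Bernstein[OF F] by (elim exE)
  then show ?thesis
    by (simp add: num_colorings_to_class_def y_def bij_betw_same_card)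
qed

end

theory Submission
  imports Defs
begin

text \<open>
  Order the vertices of \<open>H\<close> by their class.  The increasing columns property says that the adjacency
  operator \<open>nsum\<close> preserves functions that are monotone in this order, so the numbers of colorings
  of a rooted tree are monotone in the color of the root.  If \<open>\<phi>\<close> and \<open>\<psi>\<close> are monotone, then
  summing \<open>(\<phi> x - \<phi> y) (\<psi> x - \<psi> y) \<ge> 0\<close> over the walks of length \<open>q\<close> from \<open>x\<close> to \<open>y\<close> shows that
  the number of weighted colorings does not grow when one of two paths hanging at a vertex is moved
  to the far end of the other one; the assumption on the end vertices makes this strict.  By
  induction on rooted trees, each branch of a tree can be replaced by a path in this way.
\<close>

section \<open>Monotone weights on the target graph\<close>

lemma rearrangement_nat:
  fixes a b c d :: nat
  assumes "a \<le> b" "c \<le> d"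
  shows "a * d + b * c \<le> a * c + b * d"
proof -
  obtain e f where "b = a + e" "d = c + f"
    using assms le_Suc_ex by blast
  then show ?thesis
    by (simp add: algebra_simps)
qed

lemma rearrangement_strict_nat:
  fixes a b c d :: nat
  assumes "a < b" "c < d"
  shows "a * d + b * c < a * c + b * d"
proof -
  obtain e f where "b = a + Suc e" "d = c + Suc f"
    using assms less_imp_Suc_add by fastforce
  then show ?thesis
    by (simp add: algebra_simps)
qed

text \<open>The increasing columns property read at vertices: the sum of a row over the columns from
  \<open>c\<close> on counts the neighbors of rank at least \<open>c\<close>. Ranks may tie, and the
  assumption taken in both directions then makes these counts equal.\<close>

locale ranked_target = pair_pseudo_graph H for H :: "'a pair_pre_digraph" +
  fixes rank :: "'a \<Rightarrow> nat"
  assumes upper_degree_mono: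
    "\<lbrakk>x \<in> pverts H; y \<in> pverts H; rank x \<le> rank y\<rbrakk> \<Longrightarrow>
       card {w \<in> pverts H. (x, w) \<in> parcs H \<and> c \<le> rank w} \<le>
       card {w \<in> pverts H. (y, w) \<in> parcs H \<and> c \<le> rank w}"
begin

abbreviation "V \<equiv> pverts H"

definition nsum :: "('a \<Rightarrow> nat) \<Rightarrow> 'a \<Rightarrow> nat" where
  "nsum \<phi> x = (\<Sum>w | w \<in> V \<and> (x, w) \<in> parcs H. \<phi> w)"

definition deg :: "'a \<Rightarrow> nat" where
  "deg = nsum (\<lambda>_. 1)"

definition rank_mono :: "('a \<Rightarrow> nat) \<Rightarrow> bool" where
  "rank_mono \<phi> \<longleftrightarrow> (\<forall>x\<in>V. \<forall>y\<in>V. rank x \<le> rank y \<longrightarrow> \<phi> x \<le> \<phi> y)"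

text \<open>Positivity is required only off the isolated vertices, since an isolated vertex can
  color the root of no tree with an edge.\<close>

definition weight :: "('a \<Rightarrow> nat) \<Rightarrow> bool" where
  "weight \<phi> \<longleftrightarrow> rank_mono \<phi> \<and> (\<forall>x\<in>V. 0 < deg x \<longrightarrow> 0 < \<phi> x)"

text \<open>Strictness is tied to the degree, because vertices of different rank may share it; the
  assumption on end vertices provides vertices of different degrees.\<close>

definition strict_weight :: "('a \<Rightarrow> nat) \<Rightarrow> bool" where
  "strict_weight \<phi> \<longleftrightarrow> weight \<phi> \<and> (\<forall>x\<in>V. \<forall>y\<in>V. deg x < deg y \<longrightarrow> \<phi> x < \<phi> y)"

text \<open>Entry \<open>(x, y)\<close> of the \<open>q\<close>-th power of the adjacency
  matrix.\<close>

definition walks :: "nat \<Rightarrow> 'a \<Rightarrow> 'a \<Rightarrow> nat" where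
  "walks q x y = (nsum ^^ q) (\<lambda>z. if z = y then 1 else 0) x"

text \<open>The index counts edges: the path on \<open>n\<close> vertices, with the color of an end
  prescribed, has index \<open>n - 1\<close>.\<close>

definition path_weight :: "nat \<Rightarrow> 'a \<Rightarrow> nat" where
  "path_weight q = (nsum ^^ q) (\<lambda>_. 1)"

section \<open>Monotonicity of the adjacency operator\<close>

lemma finite_V [simp]: "finite V"
  by (rule pair_finite_verts)

lemma arcs_sym: "(x, y) \<in> parcs H \<longleftrightarrow> (y, x) \<in> parcs H"
  using pair_sym_arcs by (auto simp: symmetric_def dest: symD)

lemma nsum_cong: "(\<And>w. w \<in> V \<Longrightarrow> \<phi> w = \<psi> w) \<Longrightarrow> nsum \<phi> x = nsum \<psi> x"
  unfolding nsum_def by (rule sum.cong) auto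

text \<open>A superlevel set of a monotone function is closed under passing to larger rank, so the
  least rank in it is a threshold.\<close>

lemma rank_mono_up_set:
  assumes "rank_mono \<phi>"
  shows "\<exists>c. \<forall>w\<in>V. m \<le> \<phi> w \<longleftrightarrow> c \<le> rank w"
proof (cases "{w \<in> V. m \<le> \<phi> w} = {}")
  case True
  have "\<not> Suc (Max (rank ` V)) \<le> rank w" if "w \<in> V" for w
    using that by (simp add: not_le less_Suc_eq_le)
  then show ?thesis
    using True by (intro exI[of _ "Suc (Max (rank ` V))"]) blast
next
  case False
  let ?R = "rank ` {w \<in> V. m \<le> \<phi> w}"
  have "Min ?R \<in> ?R"
    using False by (intro Min_in) auto
  then obtain v where v: "v \<in> V" "m \<le> \<phi> v" "Min ?R = rank v"
    by auto
  have "m \<le> \<phi> w \<longleftrightarrow> Min ?R \<le> rank w" if w: "w \<in> V" for w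
  proof
    assume "m \<le> \<phi> w"
    then show "Min ?R \<le> rank w"
      using w by (intro Min_le) auto
  next
    assume "Min ?R \<le> rank w"
    then have "\<phi> v \<le> \<phi> w"
      using assms v w by (auto simp: rank_mono_def)
    then show "m \<le> \<phi> w"
      using v(2) by simp
  qed
  then show ?thesis
    by blast
qed

text \<open>Layer-cake summation: the value \<open>\<phi> w\<close> is the number of levels
  \<open>m \<ge> 1\<close> not above it, and the two sums are exchanged.\<close>

lemma nsum_layers:
  assumes "\<And>w. w \<in> V \<Longrightarrow> \<phi> w \<le> M"
  shows "nsum \<phi> x = (\<Sum>m=1..M. card {w \<in> V. (x, w) \<in> parcs H \<and> m \<le> \<phi> w})"
proof -
  have "\<phi> w = (\<Sum>m=1..M. if m \<le> \<phi> w then 1 else 0)" if "w \<in> V" for w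
  proof -
    have "{1..M} \<inter> {m. m \<le> \<phi> w} = {1..\<phi> w}"
      using assms[OF that] by auto
    then show ?thesis
      by (simp add: sum.If_cases)
  qed
  then have "nsum \<phi> x = (\<Sum>w | w \<in> V \<and> (x, w) \<in> parcs H. \<Sum>m=1..M. if m \<le> \<phi> w then 1 else 0)"
    unfolding nsum_def by (intro sum.cong) auto
  also have "\<dots> = (\<Sum>m=1..M. \<Sum>w | w \<in> V \<and> (x, w) \<in> parcs H. if m \<le> \<phi> w then 1 else 0)"
    by (rule sum.swap)
  also have "\<dots> = (\<Sum>m=1..M. card {w \<in> V. (x, w) \<in> parcs H \<and> m \<le> \<phi> w})"
    by (intro sum.cong refl) (simp add: sum.If_cases Int_def conj_assoc)
  finally show ?thesis .
qed

text \<open>Each layer of \<open>nsum \<phi>\<close> counts neighbors in a superlevel set, hence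
  above a rank threshold, and \<open>upper_degree_mono\<close> compares such counts.\<close>

lemma rank_mono_nsum:
  assumes "rank_mono \<phi>"
  shows "rank_mono (nsum \<phi>)"
  unfolding rank_mono_def
proof (intro ballI impI)
  fix x y assume xy: "x \<in> V" "y \<in> V" "rank x \<le> rank y"
  let ?M = "Max (\<phi> ` V)"
  have layers: "nsum \<phi> z = (\<Sum>m=1..?M. card {w \<in> V. (z, w) \<in> parcs H \<and> m \<le> \<phi> w})" for z
    by (rule nsum_layers) simp
  have "card {w \<in> V. (x, w) \<in> parcs H \<and> m \<le> \<phi> w} \<le> card {w \<in> V. (y, w) \<in> parcs H \<and> m \<le> \<phi> w}" for m
  proof -
    obtain c where "\<forall>w\<in>V. m \<le> \<phi> w \<longleftrightarrow> c \<le> rank w"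
      using rank_mono_up_set[OF assms] by blast
    then have "{w \<in> V. (z, w) \<in> parcs H \<and> m \<le> \<phi> w} = {w \<in> V. (z, w) \<in> parcs H \<and> c \<le> rank w}" for z
      by auto
    then show ?thesis
      using upper_degree_mono[OF xy] by simp
  qed
  then show "nsum \<phi> x \<le> nsum \<phi> y"
    unfolding layers by (intro sum_mono)
qed

lemma rank_mono_mult: "rank_mono \<phi> \<Longrightarrow> rank_mono \<psi> \<Longrightarrow> rank_mono (\<lambda>x. \<phi> x * \<psi> x)"
  unfolding rank_mono_def by (blast intro: mult_le_mono)

lemma weight_mult: "weight \<phi> \<Longrightarrow> weight \<psi> \<Longrightarrow> weight (\<lambda>x. \<phi> x * \<psi> x)"
  unfolding weight_def by (auto intro: rank_mono_mult)

lemma weight_one: "weight (\<lambda>_. 1)"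
  by (simp add: weight_def rank_mono_def)

lemma deg_eq: "deg x = card {w \<in> V. (x, w) \<in> parcs H}"
  by (simp add: deg_def nsum_def)

lemma deg_pos: "y \<in> V \<Longrightarrow> (x, y) \<in> parcs H \<Longrightarrow> 0 < deg x"
  by (auto simp: deg_eq card_gt_0_iff)

lemma deg_less_imp_rank_less:
  assumes "x \<in> V" "y \<in> V" "deg x < deg y"
  shows "rank x < rank y"
  using rank_mono_nsum[of "\<lambda>_. 1"] assms unfolding deg_def rank_mono_def
  by (meson linorder_not_less order_refl)

text \<open>A weight is at least 1 on every neighbour, so subtracting 1 exhibits
  \<^term>\<open>nsum \<phi>\<close> as the sum of a monotone function and the degree.\<close>

lemma strict_weight_nsum:
  assumes "weight \<phi>"
  shows "strict_weight (nsum \<phi>)"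
proof -
  let ?\<psi> = "\<lambda>w. \<phi> w - 1"
  have mono: "rank_mono ?\<psi>"
    using assms unfolding weight_def rank_mono_def by (blast intro: diff_le_mono)
  have eq: "nsum \<phi> x = nsum ?\<psi> x + deg x" if x: "x \<in> V" for x
  proof -
    have "\<phi> w = ?\<psi> w + 1" if "w \<in> V" "(x, w) \<in> parcs H" for w
      using assms deg_pos[of x w] x that arcs_sym[of x w] by (auto simp: weight_def)
    then have "nsum \<phi> x = (\<Sum>w | w \<in> V \<and> (x, w) \<in> parcs H. ?\<psi> w + 1)"
      unfolding nsum_def by (intro sum.cong) auto
    then show ?thesis
      by (simp only: nsum_def deg_def sum.distrib)
  qed
  have "nsum \<phi> x < nsum \<phi> y" if xy: "x \<in> V" "y \<in> V" "deg x < deg y" for x y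
  proof -
    have "nsum ?\<psi> x \<le> nsum ?\<psi> y"
      using rank_mono_nsum[OF mono] deg_less_imp_rank_less[OF xy] xy
      by (simp add: rank_mono_def)
    then show ?thesis
      using xy by (simp add: eq)
  qed
  then show ?thesis
    using assms rank_mono_nsum by (auto simp: strict_weight_def weight_def eq)
qed

lemma weight_path_weight: "weight (path_weight q)"
  by (induction q) (use weight_one strict_weight_nsum in \<open>auto simp: path_weight_def strict_weight_def\<close>)

lemma path_weight_0: "path_weight 0 = (\<lambda>_. 1)"
  by (simp add: path_weight_def)

lemma path_weight_Suc: "path_weight (Suc q) = nsum (path_weight q)"
  by (simp add: path_weight_def)

lemma strict_weight_path_weight: "0 < q \<Longrightarrow> strict_weight (path_weight q)"
  using strict_weight_nsum[OF weight_path_weight] by (cases q) (auto simp: path_weight_Suc)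

section \<open>Self-adjointness, counts of walks, and rearrangement along walks\<close>

lemma nsum_adjoint: "(\<Sum>x\<in>V. \<phi> x * nsum \<psi> x) = (\<Sum>x\<in>V. nsum \<phi> x * \<psi> x)"
proof -
  have "(\<Sum>x\<in>V. \<phi> x * nsum \<psi> x) = (\<Sum>x\<in>V. \<Sum>y\<in>V. if (x, y) \<in> parcs H then \<phi> x * \<psi> y else 0)"
    by (simp add: nsum_def sum_distrib_left sum.If_cases Int_def)
  also have "\<dots> = (\<Sum>y\<in>V. \<Sum>x\<in>V. if (y, x) \<in> parcs H then \<phi> x * \<psi> y else 0)"
    using arcs_sym by (subst sum.swap) simp
  also have "\<dots> = (\<Sum>x\<in>V. nsum \<phi> x * \<psi> x)"
    by (simp add: nsum_def sum_distrib_right sum.If_cases Int_def)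
  finally show ?thesis .
qed

lemma nsum_power_adjoint:
  "(\<Sum>x\<in>V. \<phi> x * (nsum ^^ q) \<psi> x) = (\<Sum>x\<in>V. (nsum ^^ q) \<phi> x * \<psi> x)"
proof (induction q arbitrary: \<phi>)
  case (Suc q)
  then show ?case
    by (simp add: nsum_adjoint) (simp add: funpow_swap1)
qed simp

text \<open>Both numbers pair the indicators of \<open>x\<close> and \<open>y\<close> through the
  self-adjoint operator \<open>nsum ^^ q\<close>; combinatorially, walks can be reversed.\<close>

lemma walks_commute:
  assumes "x \<in> V" "y \<in> V"
  shows "walks q x y = walks q y x"
proof -
  let ?\<delta> = "\<lambda>y z. if z = y then 1 else 0 :: nat"
  have "walks q x y = (\<Sum>z\<in>V. ?\<delta> x z * (nsum ^^ q) (?\<delta> y) z)"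
    using assms by (simp add: walks_def if_distrib[of "\<lambda>a. a * _"] cong: if_cong)
  also have "\<dots> = (\<Sum>z\<in>V. (nsum ^^ q) (?\<delta> x) z * ?\<delta> y z)"
    by (rule nsum_power_adjoint)
  also have "\<dots> = walks q y x"
    using assms by (simp add: walks_def if_distrib[of "\<lambda>a. _ * a"] cong: if_cong)
  finally show ?thesis .
qed

lemma walks_Suc: "walks (Suc q) x y = nsum (\<lambda>w. walks q w y) x"
  by (simp add: walks_def)

lemma nsum_power_eq_walks:
  "x \<in> V \<Longrightarrow> (nsum ^^ q) \<psi> x = (\<Sum>y\<in>V. walks q x y * \<psi> y)"
proof (induction q arbitrary: x)
  case 0
  then show ?case
    by (simp add: walks_def if_distrib[of "\<lambda>a. a * _"] eq_commute cong: if_cong)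
next
  case (Suc q)
  have "(nsum ^^ Suc q) \<psi> x = nsum (\<lambda>w. \<Sum>y\<in>V. walks q w y * \<psi> y) x"
    using Suc.IH by (auto intro: nsum_cong)
  also have "\<dots> = (\<Sum>y\<in>V. walks (Suc q) x y * \<psi> y)"
    unfolding walks_Suc nsum_def sum_distrib_right by (rule sum.swap)
  finally show ?case .
qed

lemma walks_pos:
  assumes "\<And>i. i \<le> q \<Longrightarrow> f i \<in> V" "\<And>i. i < q \<Longrightarrow> (f i, f (Suc i)) \<in> parcs H"
  shows "0 < walks q (f 0) (f q)"
  using assms
proof (induction q arbitrary: f)
  case 0
  then show ?case
    by (simp add: walks_def)
next
  case (Suc q)
  have "0 < walks q (f 1) (f (Suc q))"
    using Suc.IH[of "\<lambda>i. f (Suc i)"] Suc.prems by simp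
  moreover have "f 1 \<in> V" "(f 0, f 1) \<in> parcs H"
    using Suc.prems by auto
  ultimately show ?case
    unfolding walks_Suc nsum_def by (intro sum_pos2[of _ "f 1"]) auto
qed

text \<open>The difference between the two left-hand sides is the sum over the walks of length
  \<open>q\<close> from \<open>x\<close> to \<open>y\<close> of \<open>(\<phi> x - \<phi> y) (\<psi> x - \<psi> y)\<close>.\<close>

lemma merge_paths_double:
  "2 * (\<Sum>x\<in>V. \<phi> x * (nsum ^^ q) \<psi> x) =
     (\<Sum>x\<in>V. \<Sum>y\<in>V. walks q x y * (\<phi> x * \<psi> y + \<phi> y * \<psi> x))" (is "2 * ?l1 = ?r1")
  "2 * (\<Sum>x\<in>V. \<phi> x * \<psi> x * path_weight q x) =
     (\<Sum>x\<in>V. \<Sum>y\<in>V. walks q x y * (\<phi> x * \<psi> x + \<phi> y * \<psi> y))" (is "2 * ?l2 = ?r2")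
proof -
  \<comment> \<open>Reversing walks exchanges \<open>x\<close> and \<open>y\<close>, so twice each
    sum is the sum symmetrized in \<open>x\<close> and \<open>y\<close>. The factor 2 avoids
    halves.\<close>
  have swap: "(\<Sum>x\<in>V. \<Sum>y\<in>V. walks q x y * F y x) = (\<Sum>x\<in>V. \<Sum>y\<in>V. walks q x y * F x y)" for F
    by (subst sum.swap) (simp add: walks_commute cong: sum.cong)
  have "?l1 = (\<Sum>x\<in>V. \<Sum>y\<in>V. walks q x y * (\<phi> x * \<psi> y))"
    by (simp add: nsum_power_eq_walks sum_distrib_left mult_ac)
  then show "2 * ?l1 = ?r1"
    using swap[of "\<lambda>x y. \<phi> x * \<psi> y"] by (simp add: sum.distrib distrib_left)
  have "?l2 = (\<Sum>x\<in>V. \<Sum>y\<in>V. walks q x y * (\<phi> x * \<psi> x))"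
    by (simp add: path_weight_def nsum_power_eq_walks sum_distrib_left mult_ac)
  then show "2 * ?l2 = ?r2"
    using swap[of "\<lambda>x y. \<phi> x * \<psi> x"] by (simp add: sum.distrib distrib_left)
qed

text \<open>Being monotone in the same rank, \<phi> and \<psi> are similarly ordered at
  \<open>x\<close> and \<open>y\<close>, whichever of the two has the larger rank.\<close>

lemma merge_term:
  assumes "rank_mono \<phi>" "rank_mono \<psi>" "x \<in> V" "y \<in> V"
  shows "\<phi> x * \<psi> y + \<phi> y * \<psi> x \<le> \<phi> x * \<psi> x + \<phi> y * \<psi> y"
proof (cases "rank x \<le> rank y")
  case True
  then show ?thesis
    using assms by (intro rearrangement_nat) (auto simp: rank_mono_def)
next
  case False
  then show ?thesis
    using assms rearrangement_nat[of "\<phi> y" "\<phi> x" "\<psi> y" "\<psi> x"] by (auto simp: rank_mono_def)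
qed

text \<open>On the left \<phi> and \<psi> sit at opposite ends of a path with \<open>q\<close>
  edges; on the right \<psi> has moved to the end of \<phi> and the path hangs free.\<close>

lemma merge_paths:
  assumes "rank_mono \<phi>" "rank_mono \<psi>"
  shows "(\<Sum>x\<in>V. \<phi> x * (nsum ^^ q) \<psi> x) \<le> (\<Sum>x\<in>V. \<phi> x * \<psi> x * path_weight q x)"
proof -
  have "2 * (\<Sum>x\<in>V. \<phi> x * (nsum ^^ q) \<psi> x) \<le> 2 * (\<Sum>x\<in>V. \<phi> x * \<psi> x * path_weight q x)"
    unfolding merge_paths_double by (intro sum_mono mult_le_mono2 merge_term assms)
  then show ?thesis
    by simp
qed

text \<open>One strict term is enough: the degrees separate both weights at \<open>a\<close> and
  \<open>b\<close>, and a walk from \<open>a\<close> to \<open>b\<close> gives this pair a positive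
  coefficient.\<close>

lemma merge_paths_strict:
  assumes \<phi>: "strict_weight \<phi>" and \<psi>: "strict_weight \<psi>"
    and ab: "a \<in> V" "b \<in> V" "deg a < deg b" "0 < walks q a b"
  shows "(\<Sum>x\<in>V. \<phi> x * (nsum ^^ q) \<psi> x) < (\<Sum>x\<in>V. \<phi> x * \<psi> x * path_weight q x)"
proof -
  have m: "rank_mono \<phi>" "rank_mono \<psi>"
    using \<phi> \<psi> by (auto simp: strict_weight_def weight_def)
  have ab': "\<phi> a * \<psi> b + \<phi> b * \<psi> a < \<phi> a * \<psi> a + \<phi> b * \<psi> b"
    using \<phi> \<psi> ab by (intro rearrangement_strict_nat) (auto simp: strict_weight_def)
  have "2 * (\<Sum>x\<in>V. \<phi> x * (nsum ^^ q) \<psi> x) < 2 * (\<Sum>x\<in>V. \<phi> x * \<psi> x * path_weight q x)"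
    unfolding merge_paths_double
  proof (rule sum_strict_mono_ex1, simp)
    show "\<forall>x\<in>V. (\<Sum>y\<in>V. walks q x y * (\<phi> x * \<psi> y + \<phi> y * \<psi> x)) \<le>
        (\<Sum>y\<in>V. walks q x y * (\<phi> x * \<psi> x + \<phi> y * \<psi> y))"
      by (intro ballI sum_mono mult_le_mono2 merge_term m)
    have "(\<Sum>y\<in>V. walks q a y * (\<phi> a * \<psi> y + \<phi> y * \<psi> a)) <
        (\<Sum>y\<in>V. walks q a y * (\<phi> a * \<psi> a + \<phi> y * \<psi> y))"
    proof (rule sum_strict_mono_ex1, simp)
      show "\<forall>y\<in>V. walks q a y * (\<phi> a * \<psi> y + \<phi> y * \<psi> a) \<le> walks q a y * (\<phi> a * \<psi> a + \<phi> y * \<psi> y)"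
        using ab(1) by (intro ballI mult_le_mono2 merge_term m)
      show "\<exists>y\<in>V. walks q a y * (\<phi> a * \<psi> y + \<phi> y * \<psi> a) < walks q a y * (\<phi> a * \<psi> a + \<phi> y * \<psi> y)"
        using ab ab' by (intro bexI[of _ b]) auto
    qed
    then show "\<exists>x\<in>V. (\<Sum>y\<in>V. walks q x y * (\<phi> x * \<psi> y + \<phi> y * \<psi> x)) <
        (\<Sum>y\<in>V. walks q x y * (\<phi> x * \<psi> x + \<phi> y * \<psi> y))"
      using ab(1) by blast
  qed
  then show ?thesis
    by simp
qed

end

section \<open>Rooted trees\<close>

text \<open>Branches are attached one at a time, each by an edge between the two roots, so that
  every inductive step splits a tree at one edge.\<close>

inductive rooted_tree :: "'b set \<Rightarrow> 'b rel \<Rightarrow> 'b \<Rightarrow> bool" where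
  single: "rooted_tree {u} {} u"
| join: "\<lbrakk>rooted_tree A E u; rooted_tree B F v; A \<inter> B = {}\<rbrakk> \<Longrightarrow>
    rooted_tree (A \<union> B) (E \<union> F \<union> {(u, v), (v, u)}) u"

text \<open>The root is an end of the path; a path with an inner root is not of this form.\<close>

inductive rooted_path :: "'b set \<Rightarrow> 'b rel \<Rightarrow> 'b \<Rightarrow> bool" where
  single: "rooted_path {u} {} u"
| extend: "\<lbrakk>rooted_path B F v; u \<notin> B\<rbrakk> \<Longrightarrow> rooted_path (insert u B) (F \<union> {(u, v), (v, u)}) u"

lemma rooted_treeD:
  assumes "rooted_tree A E u"
  shows "finite A" "u \<in> A" "E \<subseteq> A \<times> A"
proof -
  have "finite A \<and> u \<in> A \<and> E \<subseteq> A \<times> A"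
    using assms by induction auto
  then show "finite A" "u \<in> A" "E \<subseteq> A \<times> A"
    by auto
qed

lemma card_rooted_tree_pos: "rooted_tree A E u \<Longrightarrow> 0 < card A"
  by (auto simp: card_gt_0_iff dest: rooted_treeD)

text \<open>Written in numbers of edges: \<open>card A - 1\<close> for a path on \<open>A\<close>,
  and \<open>card B\<close> for a path on \<open>B\<close> lengthened by the joining edge. This is
  the \<open>p + q\<close> of \<open>merge_path_weights\<close>.\<close>

lemma card_rooted_tree_join:
  assumes "rooted_tree A E u" "rooted_tree B F v" "A \<inter> B = {}"
  shows "card (A \<union> B) - 1 = (card A - 1) + card B"
  using rooted_treeD(1)[OF assms(1)] rooted_treeD(1)[OF assms(2)] assms(3)
    card_rooted_tree_pos[OF assms(1)]
  by (simp add: card_Un_disjoint)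

lemma rooted_path_imp_rooted_tree: "rooted_path A E u \<Longrightarrow> rooted_tree A E u"
proof (induction rule: rooted_path.induct)
  case (extend B F v u)
  then show ?case
    using rooted_tree.join[OF rooted_tree.single[of u], of B F v] by simp
qed (rule rooted_tree.single)

text \<open>The first path is used up from its root: its root becomes a new root above the second
  path, and the rest is joined to that. The \<open>w\<close> so reached is the far end of the first
  path.\<close>

lemma rooted_path_join:
  assumes "rooted_path A E u" "rooted_path B F v" "A \<inter> B = {}"
  shows "\<exists>w. rooted_path (A \<union> B) (E \<union> F \<union> {(u, v), (v, u)}) w"
  using assms
proof (induction arbitrary: B F v rule: rooted_path.induct)
  case (single u)
  then have "rooted_path (insert u B) (F \<union> {(u, v), (v, u)}) u"
    by (intro rooted_path.extend) auto
  then show ?case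
    by auto
next
  case (extend A E u' u)
  have "rooted_path (insert u B) (F \<union> {(u, v), (v, u)}) u"
    using extend.prems by (intro rooted_path.extend) auto
  then obtain w where "rooted_path (A \<union> insert u B) (E \<union> (F \<union> {(u, v), (v, u)}) \<union> {(u', u), (u, u')}) w"
    using extend.IH[of "insert u B" "F \<union> {(u, v), (v, u)}" u] extend.hyps extend.prems by auto
  moreover have "E \<union> (F \<union> {(u, v), (v, u)}) \<union> {(u', u), (u, u')} =
      E \<union> {(u, u'), (u', u)} \<union> F \<union> {(u, v), (v, u)}"
    by blast
  ultimately show ?case
    by auto
qed

section \<open>From graphs to rooted paths and rooted trees\<close>

lemma parcs_path_graph_Suc:
  "0 < n \<Longrightarrow> parcs (path_graph (Suc n)) = parcs (path_graph n) \<union> {(Suc n, n), (n, Suc n)}"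
  by (auto simp: path_graph_def)

lemma rooted_path_path_graph: "0 < n \<Longrightarrow> rooted_path {1..n} (parcs (path_graph n)) n"
proof (induction n rule: nat_induct_non_zero)
  case 1
  have "parcs (path_graph 1) = {}"
    by (auto simp: path_graph_def)
  then show ?case
    using rooted_path.single[of "Suc 0"] by simp
next
  case (Suc n)
  then show ?case
    using rooted_path.extend[OF Suc.IH, of "Suc n"]
    by (simp add: parcs_path_graph_Suc atLeastAtMostSuc_conv)
qed

text \<open>Numbering starts at the far end, so an added root takes the next number and the others
  keep theirs.\<close>

lemma rooted_path_numbering:
  assumes "rooted_path A E u"
  shows "\<exists>f. bij_betw f A {1..card A} \<and> f u = card A \<and> map_prod f f ` E = parcs (path_graph (card A))"
  using assms
proof (induction rule: rooted_path.induct)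
  case (single u)
  then show ?case
    by (intro exI[of _ "\<lambda>_. 1"]) (auto simp: path_graph_def bij_betw_def)
next
  case (extend B F v u)
  note B = rooted_treeD[OF rooted_path_imp_rooted_tree[OF extend.hyps(1)]]
  obtain f where f: "bij_betw f B {1..card B}" "f v = card B"
      "map_prod f f ` F = parcs (path_graph (card B))"
    using extend.IH by blast
  let ?n = "card B"
  let ?g = "f(u := Suc ?n)"
  have n: "card (insert u B) = Suc ?n" "0 < ?n"
    using B extend.hyps(2) by (auto simp: card_gt_0_iff)
  have "bij_betw ?g B {1..?n}"
    using f(1) extend.hyps(2) by (subst bij_betw_cong[where g = f]) auto
  then have "bij_betw ?g (insert u B) (insert (?g u) {1..?n})"
    using extend.hyps(2) by (subst notIn_Un_bij_betw3[simplified, symmetric]) auto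
  then have "bij_betw ?g (insert u B) {1..card (insert u B)}"
    by (simp add: n atLeastAtMostSuc_conv del: fun_upd_apply) simp
  moreover have "map_prod ?g ?g ` F = map_prod f f ` F"
    using B(3) extend.hyps(2) by (intro image_cong) auto
  then have "map_prod ?g ?g ` (F \<union> {(u, v), (v, u)}) = parcs (path_graph (card (insert u B)))"
    using f extend.hyps(2) B(2) n(2)
    by (simp only: image_Un f(3) n(1) parcs_path_graph_Suc) auto
  ultimately show ?case
    using n(1) by (intro exI[of _ ?g]) (simp only: fun_upd_same)
qed

lemma rooted_path_digraph_iso:
  assumes T: "pair_wf_digraph T" and path: "rooted_path (pverts T) (parcs T) u"
  shows "digraph_iso (with_proj T) (with_proj (path_graph (card (pverts T))))"
proof -
  interpret pair_wf_digraph T by fact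
  obtain f where f: "bij_betw f (pverts T) {1..card (pverts T)}"
      "map_prod f f ` parcs T = parcs (path_graph (card (pverts T)))"
    using rooted_path_numbering[OF path] by blast
  let ?f = "\<lparr>iso_verts = f, iso_arcs = map_prod f f, iso_head = snd, iso_tail = fst\<rparr>"
  have inj: "inj_on f (pverts T)"
    using f(1) by (auto simp: bij_betw_def)
  have "parcs T \<subseteq> pverts T \<times> pverts T"
    by (auto dest: in_arcsD1 in_arcsD2)
  then have "inj_on (map_prod f f) (parcs T)"
    using map_prod_inj_on[OF inj inj] inj_on_subset by blast
  then have "pre_digraph.digraph_isomorphism (with_proj T) ?f"
    using inj wf_digraph by (simp add: digraph_isomorphism_def)
  moreover have "with_proj (path_graph (card (pverts T))) = app_iso ?f (with_proj T)"
    using f by (simp add: app_iso_def with_proj_def bij_betw_def) (simp add: path_graph_def)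
  ultimately show ?thesis
    unfolding digraph_iso_def by blast
qed

text \<open>Deleting an edge \<open>uv\<close> at the root leaves two components, as the edge is a
  bridge. Both inherit the bridge property and are smaller, so induction makes them rooted trees, to
  be joined again along \<open>uv\<close>.\<close>

lemma rooted_tree_if_bridges:
  assumes "finite A" "E \<subseteq> A \<times> A" "sym E" "u \<in> A" "\<And>x. x \<in> A \<Longrightarrow> (u, x) \<in> E\<^sup>*"
    and bridge: "\<And>x y. (x, y) \<in> E \<Longrightarrow> (x, y) \<notin> (E - {(x, y), (y, x)})\<^sup>*"
  shows "rooted_tree A E u"
  using assms
proof (induction "card A" arbitrary: A E u rule: less_induct)
  case less
  note fin = less.prems(1) and EA = less.prems(2) and symE = less.prems(3) and u = less.prems(4)
    and conn = less.prems(5) and bridge = less.prems(6)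
  show ?case
  proof (cases "A = {u}")
    case True
    \<comment> \<open>A loop is no bridge: its end is reachable from itself by the empty
      walk.\<close>
    have "(u, u) \<notin> E"
      using bridge by blast
    then have "E = {}"
      using EA True by auto
    then show ?thesis
      using True by (simp add: rooted_tree.single)
  next
    case False
    then obtain x where "x \<in> A" "x \<noteq> u"
      using u by blast
    then obtain v where uv: "(u, v) \<in> E"
      using conn by (metis converse_rtranclE)
    let ?E' = "E - {(u, v), (v, u)}"
    let ?C = "\<lambda>w. {x. (w, x) \<in> ?E'\<^sup>*}"
    let ?R = "\<lambda>w. E \<inter> ?C w \<times> ?C w"
    have sym': "sym (?E'\<^sup>*)"
      using symE by (intro sym_rtrancl) (auto simp: sym_def)
    have disj: "?C u \<inter> ?C v = {}"
      using bridge[OF uv] sym' by (auto dest: symD rtrancl_trans)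
    have inA: "?C w \<subseteq> A" if "w \<in> A" for w
    proof
      fix x assume "x \<in> ?C w"
      then have "(w, x) \<in> ?E'\<^sup>*" by simp
      then show "x \<in> A"
        using EA that by (induction rule: rtrancl_induct) auto
    qed
    have vA: "v \<in> A"
      using uv EA by auto
    have cover: "A = ?C u \<union> ?C v"
    proof
      \<comment> \<open>A walk from \<open>u\<close> leaves the remaining arcs only along
        \<open>uv\<close>, and both ends of that edge lie in the union.\<close>
      show "A \<subseteq> ?C u \<union> ?C v"
      proof
        fix x assume "x \<in> A"
        then have "(u, x) \<in> E\<^sup>*" by (rule conn)
        then show "x \<in> ?C u \<union> ?C v"
        proof (induction rule: rtrancl_induct)
          case (step y z)
          then show ?case
            by (cases "(y, z) \<in> ?E'") (auto intro: rtrancl_into_rtrancl)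
        qed simp
      qed
    qed (use inA u vA in blast)
    have closed: "x \<in> ?C w \<longleftrightarrow> y \<in> ?C w" if "(x, y) \<in> ?E'" for x y w
    proof -
      have "(y, x) \<in> ?E'"
        using that symE by (auto simp: sym_def)
      then show ?thesis
        using that by (auto intro: rtrancl_into_rtrancl)
    qed
    have E_eq: "E = ?R u \<union> ?R v \<union> {(u, v), (v, u)}"
    proof
      show "E \<subseteq> ?R u \<union> ?R v \<union> {(u, v), (v, u)}"
      proof
        fix e assume "e \<in> E"
        obtain x y where e: "e = (x, y)" by (cases e)
        show "e \<in> ?R u \<union> ?R v \<union> {(u, v), (v, u)}"
        proof (cases "e \<in> ?E'")
          case True
          then have "x \<in> ?C u \<longleftrightarrow> y \<in> ?C u" "x \<in> ?C v \<longleftrightarrow> y \<in> ?C v"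
            using closed[of x y] e by blast+
          moreover have "x \<in> ?C u \<union> ?C v"
            using \<open>e \<in> E\<close> EA cover e by blast
          ultimately show ?thesis
            using \<open>e \<in> E\<close> e by blast
        qed (use \<open>e \<in> E\<close> in blast)
      qed
    qed (use uv symE in \<open>auto dest: symD\<close>)
    have tree: "rooted_tree (?C w) (?R w) w" if w: "w = u \<or> w = v" for w
    proof (rule less.hyps)
      have "u \<in> ?C u" "v \<in> ?C v"
        by simp_all
      then have "?C w \<subset> A"
        using w disj cover by blast
      then show "card (?C w) < card A"
        by (rule psubset_card_mono[OF fin])
      show "finite (?C w)"
        using \<open>?C w \<subset> A\<close> fin by (blast intro: finite_subset)
      show "?R w \<subseteq> ?C w \<times> ?C w" "w \<in> ?C w"
        by auto
      show "sym (?R w)"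
        using symE by (auto simp: sym_def)
      show "(w, x) \<in> (?R w)\<^sup>*" if "x \<in> ?C w" for x
      proof -
        have "(w, x) \<in> ?E'\<^sup>*"
          using that by simp
        then show ?thesis
        proof (induction rule: rtrancl_induct)
          case (step y z)
          then have "(y, z) \<in> ?R w"
            by (auto intro: rtrancl_into_rtrancl)
          then show ?case
            by (rule rtrancl_into_rtrancl[OF step.IH])
        qed simp
      qed
      show "(x, y) \<notin> (?R w - {(x, y), (y, x)})\<^sup>*" if "(x, y) \<in> ?R w" for x y
      proof -
        have "(?R w - {(x, y), (y, x)})\<^sup>* \<subseteq> (E - {(x, y), (y, x)})\<^sup>*"
          by (intro rtrancl_mono) auto
        then show ?thesis
          using bridge[of x y] that by blast
      qed
    qed
    have "rooted_tree (?C u \<union> ?C v) (?R u \<union> ?R v \<union> {(u, v), (v, u)}) u"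
      using tree disj by (intro rooted_tree.join) simp_all
    then show ?thesis
      using E_eq cover by simp
  qed
qed

text \<open>If \<open>y\<close> stayed reachable from \<open>x\<close>, a simple path from
  \<open>x\<close> to \<open>y\<close> avoiding the edge would close up with the arc
  \<open>(y, x)\<close> to a cycle.\<close>

lemma graph_tree_bridge:
  assumes T: "graph_tree T" and xy: "(x, y) \<in> parcs T"
  shows "(x, y) \<notin> (parcs T - {(x, y), (y, x)})\<^sup>*"
proof
  assume reach: "(x, y) \<in> (parcs T - {(x, y), (y, x)})\<^sup>*"
  interpret pair_graph T
    using T by (simp add: graph_tree_def)
  define D where "D = \<lparr>pverts = pverts T, parcs = parcs T - {(x, y), (y, x)}\<rparr>"
  interpret D: pair_wf_digraph D
    by unfold_locales (auto simp: D_def in_arcsD1 in_arcsD2)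
  have neq: "x \<noteq> y"
    using xy no_loops' by blast
  then have "(x, y) \<in> (parcs D)\<^sup>+"
    using reach by (auto simp: D_def rtrancl_eq_or_trancl)
  then have "x \<rightarrow>\<^sup>*\<^bsub>with_proj D\<^esub> y"
    using D.reachable1_reachable by simp
  then obtain p where p: "D.apath x p y"
    using D.reachable_apath by blast
  have arcs: "set p \<subseteq> parcs D" "pcas x p y" "distinct (pawalk_verts x p)"
    using p by (auto simp: D.apath_def D.awalk_def)
  \<comment> \<open>A path with one arc would be the deleted edge itself. Hence the cycle has length
    at least three and is not an edge run back and forth.\<close>
  have len: "2 \<le> length p"
  proof (rule ccontr)
    assume "\<not> 2 \<le> length p"
    then consider "p = []" | e where "p = [e]"
      by (cases p; cases "tl p") auto
    then show False
      using arcs neq by cases (auto simp: D_def)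
  qed
  have "(y, x) \<in> parcs T"
    using xy pair_sym_arcs by (auto simp: symmetric_def dest: symD)
  then have "cycle ((y, x) # p)"
    using arcs in_arcsD2[OF xy] by (auto simp: cycle_def awalk_def D_def)
  then show False
    using T len unfolding graph_tree_def by force
qed

lemma graph_tree_imp_rooted_tree:
  assumes T: "graph_tree T" and u: "u \<in> pverts T"
  shows "rooted_tree (pverts T) (parcs T) u"
proof -
  interpret pair_graph T
    using T by (simp add: graph_tree_def)
  show ?thesis
  proof (rule rooted_tree_if_bridges)
    show "finite (pverts T)" "u \<in> pverts T"
      using u pair_finite_verts by auto
    show "parcs T \<subseteq> pverts T \<times> pverts T"
      by (auto dest: in_arcsD1 in_arcsD2)
    show "sym (parcs T)"
      using pair_sym_arcs by (simp add: symmetric_def)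
    show "(u, x) \<in> (parcs T)\<^sup>*" if "x \<in> pverts T" for x
    proof -
      have "strongly_connected (with_proj (mk_symmetric (with_proj T)))"
        using T by (simp add: graph_tree_def connected_def)
      then have "u \<rightarrow>\<^sup>*\<^bsub>with_proj (mk_symmetric (with_proj T))\<^esub> x"
        using u that by (auto simp: strongly_connected_def)
      then have "u \<rightarrow>\<^sup>*\<^bsub>with_proj T\<^esub> x"
        using reachable_mk_symmetric_eq[OF pair_sym_arcs] by simp
      then show ?thesis
        by (auto dest: reachable_rtranclI)
    qed
    show "(x, y) \<notin> (parcs T - {(x, y), (y, x)})\<^sup>*" if "(x, y) \<in> parcs T" for x y
      using graph_tree_bridge[OF T that] .
  qed
qed

section \<open>Counting colorings of rooted trees\<close>

context ranked_target
begin

definition rooted_count :: "'b set \<Rightarrow> 'b rel \<Rightarrow> 'b \<Rightarrow> 'a \<Rightarrow> nat" where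
  "rooted_count A E u x = card {f \<in> colorings \<lparr>pverts = A, parcs = E\<rparr> H. f u = x}"

lemma finite_colorings: "finite (pverts G) \<Longrightarrow> finite (colorings G H)"
  unfolding colorings_def
  by (rule finite_subset[OF _ finite_PiE[of "pverts G" "\<lambda>_. V"]]) auto

lemma num_colorings_eq_sum:
  assumes "finite A" "u \<in> A"
  shows "num_colorings \<lparr>pverts = A, parcs = E\<rparr> H = (\<Sum>x\<in>V. rooted_count A E u x)"
proof -
  let ?C = "colorings \<lparr>pverts = A, parcs = E\<rparr> H"
  have "?C = (\<Union>x\<in>V. {f \<in> ?C. f u = x})"
    using assms(2) by (auto simp: colorings_def)
  then have "card ?C = card (\<Union>x\<in>V. {f \<in> ?C. f u = x})"
    by simp
  also have "\<dots> = (\<Sum>x\<in>V. card {f \<in> ?C. f u = x})"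
    using finite_colorings[of "\<lparr>pverts = A, parcs = E\<rparr>"] assms(1)
    by (intro card_UN_disjoint) auto
  finally show ?thesis
    by (simp add: num_colorings_def rooted_count_def)
qed

lemma rooted_count_single: "x \<in> V \<Longrightarrow> rooted_count {u} {} u x = 1"
proof -
  assume "x \<in> V"
  then have "{f \<in> colorings \<lparr>pverts = {u}, parcs = {}\<rparr> H. f u = x} = {\<lambda>z\<in>{u}. x}"
    by (auto simp: colorings_def PiE_def extensional_def fun_eq_iff)
  then show ?thesis
    by (simp add: rooted_count_def)
qed

text \<open>Restriction and gluing identify a coloring of the joined tree with a pair of colorings
  of its two disjoint parts whose root colors are adjacent.\<close>

lemma rooted_count_join:
  assumes A: "rooted_tree A E u" and B: "rooted_tree B F v" and disj: "A \<inter> B = {}" and x: "x \<in> V"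
  shows "rooted_count (A \<union> B) (E \<union> F \<union> {(u, v), (v, u)}) u x =
    rooted_count A E u x * nsum (rooted_count B F v) x"
proof -
  note A = rooted_treeD[OF A] and B = rooted_treeD[OF B]
  let ?G = "\<lparr>pverts = A, parcs = E\<rparr>" and ?G' = "\<lparr>pverts = B, parcs = F\<rparr>"
  let ?J = "\<lparr>pverts = A \<union> B, parcs = E \<union> F \<union> {(u, v), (v, u)}\<rparr>"
  let ?N = "{w \<in> V. (x, w) \<in> parcs H}"
  let ?L = "{f \<in> colorings ?J H. f u = x}"
  let ?R = "{f \<in> colorings ?G H. f u = x} \<times> (\<Union>w\<in>?N. {g \<in> colorings ?G' H. g v = w})"
  have "bij_betw (\<lambda>f. (restrict f A, restrict f B)) ?L ?R"
  proof (rule bij_betw_byWitness)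
    let ?glue = "\<lambda>(f, g) z. if z \<in> A then f z else g z"
    show "\<forall>f\<in>?L. ?glue (restrict f A, restrict f B) = f"
      by (auto simp: colorings_def PiE_def extensional_def fun_eq_iff)
    show "\<forall>p\<in>?R. (restrict (?glue p) A, restrict (?glue p) B) = p"
      using disj by (auto simp: colorings_def PiE_def extensional_def fun_eq_iff)
    show "(\<lambda>f. (restrict f A, restrict f B)) ` ?L \<subseteq> ?R"
      using A B by (auto simp: colorings_def)
    show "?glue ` ?R \<subseteq> ?L"
    proof (rule image_subsetI)
      fix p assume "p \<in> ?R"
      then obtain f g where p: "p = (f, g)" and f: "f \<in> colorings ?G H" "f u = x"
        and g: "g \<in> colorings ?G' H" and fg: "(f u, g v) \<in> parcs H"
        by auto
      let ?h = "\<lambda>z. if z \<in> A then f z else g z"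
      have hA: "?h z = f z" if "z \<in> A" for z
        using that by simp
      have hB: "?h z = g z" if "z \<in> B" for z
        using that disj by auto
      have "?h \<in> A \<union> B \<rightarrow>\<^sub>E V"
        using f(1) g by (auto simp: colorings_def PiE_def extensional_def Pi_def)
      moreover have "(?h a, ?h b) \<in> parcs H" if arc: "(a, b) \<in> parcs ?J" for a b
      proof -
        consider "(a, b) \<in> E" | "(a, b) \<in> F" | "a = u" "b = v" | "a = v" "b = u"
          using arc by auto
        then show ?thesis
        proof cases
          case 1
          then have "a \<in> A" "b \<in> A"
            using A(3) by auto
          then show ?thesis
            using f(1) 1 by (simp add: colorings_def)
        next
          case 2
          then have "a \<in> B" "b \<in> B"
            using B(3) by auto
          then show ?thesis
            unfolding hB[OF \<open>a \<in> B\<close>] hB[OF \<open>b \<in> B\<close>] using g 2 by (simp add: colorings_def)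
        next
          case 3
          show ?thesis
            unfolding 3 hA[OF A(2)] hB[OF B(2)] by (rule fg)
        next
          case 4
          show ?thesis
            unfolding 4 hA[OF A(2)] hB[OF B(2)] using fg by (simp add: arcs_sym)
        qed
      qed
      ultimately have "?h \<in> colorings ?J H"
        by (simp add: colorings_def)
      then show "?glue p \<in> ?L"
        using hA[OF A(2)] f(2) by (simp add: p)
    qed
  qed
  then have "rooted_count (A \<union> B) (E \<union> F \<union> {(u, v), (v, u)}) u x = card ?R"
    by (simp add: rooted_count_def bij_betw_same_card)
  also have "card (\<Union>w\<in>?N. {g \<in> colorings ?G' H. g v = w}) = nsum (rooted_count B F v) x"
    unfolding nsum_def rooted_count_def
    using finite_colorings[of ?G'] B(1) by (intro card_UN_disjoint) auto
  then have "card ?R = rooted_count A E u x * nsum (rooted_count B F v) x"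
    by (simp add: card_cartesian_product rooted_count_def)
  finally show ?thesis .
qed

section \<open>Comparison of branches with paths\<close>

lemma weight_cong: "(\<And>x. x \<in> V \<Longrightarrow> \<phi> x = \<psi> x) \<Longrightarrow> weight \<phi> \<longleftrightarrow> weight \<psi>"
  by (simp add: weight_def rank_mono_def)

text \<open>Joining multiplies by a neighbor sum, and both operations preserve weights. This lets a
  part of a tree serve as weight for the rest.\<close>

lemma weight_rooted_count: "rooted_tree A E u \<Longrightarrow> weight (rooted_count A E u)"
proof (induction rule: rooted_tree.induct)
  case (single u)
  then show ?case
    using weight_one by (subst weight_cong[of _ "\<lambda>_. 1"]) (simp_all only: rooted_count_single)
next
  case (join A E u B F v)
  then have "weight (\<lambda>x. rooted_count A E u x * nsum (rooted_count B F v) x)"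
    using strict_weight_nsum by (intro weight_mult) (auto simp: strict_weight_def)
  then show ?case
    by (subst weight_cong) (rule rooted_count_join[OF join.hyps])
qed

lemma rooted_count_path:
  "rooted_path A E u \<Longrightarrow> x \<in> V \<Longrightarrow> rooted_count A E u x = path_weight (card A - 1) x"
proof (induction arbitrary: x rule: rooted_path.induct)
  case (single u)
  then show ?case
    by (simp add: rooted_count_single path_weight_0)
next
  case (extend B F v u)
  note tree = rooted_path_imp_rooted_tree[OF extend.hyps(1)]
  note B = rooted_treeD[OF tree]
  have "rooted_count (insert u B) (F \<union> {(u, v), (v, u)}) u x = nsum (rooted_count B F v) x"
    using rooted_count_join[OF rooted_tree.single[of u] tree] extend.hyps(2) extend.prems
    by (simp add: rooted_count_single)
  also have "\<dots> = nsum (path_weight (card B - 1)) x"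
    using extend.IH by (intro nsum_cong)
  also have "\<dots> = path_weight (card (insert u B) - 1) x"
    using B extend.hyps(2)
    by (cases "card B") (auto simp: path_weight_Suc[symmetric])
  finally show ?case .
qed

text \<open>Self-adjointness moves the point of view from \<open>u\<close> to \<open>v\<close>: seen
  across the edge, everything outside \<open>B\<close> becomes a single weight on the color of
  \<open>v\<close>.\<close>

lemma sum_rooted_count_join:
  assumes "rooted_tree A E u" "rooted_tree B F v" "A \<inter> B = {}"
  shows "(\<Sum>x\<in>V. \<phi> x * rooted_count (A \<union> B) (E \<union> F \<union> {(u, v), (v, u)}) u x) =
    (\<Sum>x\<in>V. nsum (\<lambda>x. \<phi> x * rooted_count A E u x) x * rooted_count B F v x)"
  unfolding nsum_adjoint[symmetric]
  by (intro sum.cong refl) (simp only: rooted_count_join[OF assms] mult.assoc)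

text \<open>Back from \<open>v\<close> to \<open>u\<close>: a path with \<open>q\<close> edges
  hanging at \<open>v\<close> has \<open>q + 1\<close> edges when seen from
  \<open>u\<close>.\<close>

lemma sum_nsum_path_weight:
  "(\<Sum>x\<in>V. nsum (\<lambda>x. \<phi> x * \<psi> x) x * path_weight q x) =
     (\<Sum>x\<in>V. (\<phi> x * path_weight (Suc q) x) * \<psi> x)"
  unfolding nsum_adjoint[symmetric] path_weight_Suc by (simp add: mult_ac)

lemma path_weight_add: "path_weight (p + q) = (nsum ^^ q) (path_weight p)"
  by (simp add: path_weight_def add.commute[of p] funpow_add)

text \<open>The path is cut \<open>q\<close> edges from its weighted end, and the last
  \<open>p\<close> edges are moved to that end: \<open>merge_paths\<close> with the cut-off piece as
  second weight.\<close>

lemma merge_path_weights: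
  assumes "rank_mono \<phi>"
  shows "(\<Sum>x\<in>V. \<phi> x * path_weight (p + q) x) \<le> (\<Sum>x\<in>V. \<phi> x * path_weight q x * path_weight p x)"
  using merge_paths[OF assms, of "path_weight p" q] weight_path_weight[of p]
  by (simp add: weight_def path_weight_add mult_ac)

text \<open>Every branch, and then the tree itself, is replaced by a path hanging at the root; the weight
  \<open>\<phi>\<close> stands for the rest of the graph.\<close>

lemma path_weight_le_rooted_count:
  assumes "rooted_tree A E u" "rank_mono \<phi>"
  shows "(\<Sum>x\<in>V. \<phi> x * path_weight (card A - 1) x) \<le> (\<Sum>x\<in>V. \<phi> x * rooted_count A E u x)"
  using assms
proof (induction arbitrary: \<phi> rule: rooted_tree.induct)
  case (single u)
  then show ?case
    by (simp add: path_weight_0 rooted_count_single)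
next
  case (join A E u B F v)
  note pos = card_rooted_tree_pos[OF join.hyps(1)] card_rooted_tree_pos[OF join.hyps(2)]
  note card = card_rooted_tree_join[OF join.hyps]
  have mono: "rank_mono (\<lambda>x. \<phi> x * rooted_count A E u x)" "rank_mono (\<lambda>x. \<phi> x * path_weight (card B) x)"
    using join.prems weight_rooted_count[OF join.hyps(1)] weight_path_weight
    by (auto intro!: rank_mono_mult simp: weight_def)
  \<comment> \<open>The path is folded at the root: \<open>card B\<close> edges stand for the branch
    with its joining edge, \<open>card A - 1\<close> for the rest.\<close>
  have "(\<Sum>x\<in>V. \<phi> x * path_weight (card (A \<union> B) - 1) x) \<le>
      (\<Sum>x\<in>V. \<phi> x * path_weight (card B) x * path_weight (card A - 1) x)"
    unfolding card by (rule merge_path_weights[OF join.prems])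
  also have "\<dots> \<le> (\<Sum>x\<in>V. \<phi> x * path_weight (card B) x * rooted_count A E u x)"
    by (rule join.IH(1)[OF mono(2)])
  \<comment> \<open>The first of the \<open>card B\<close> edges becomes the edge from
    \<open>u\<close> to \<open>v\<close>, which leaves a path with \<open>card B - 1\<close> edges
    at \<open>v\<close>.\<close>
  also have "\<dots> = (\<Sum>x\<in>V. nsum (\<lambda>x. \<phi> x * rooted_count A E u x) x * path_weight (card B - 1) x)"
    unfolding sum_nsum_path_weight using pos by simp
  also have "\<dots> \<le> (\<Sum>x\<in>V. nsum (\<lambda>x. \<phi> x * rooted_count A E u x) x * rooted_count B F v x)"
    by (rule join.IH(2)[OF rank_mono_nsum[OF mono(1)]])
  also have "\<dots> = (\<Sum>x\<in>V. \<phi> x * rooted_count (A \<union> B) (E \<union> F \<union> {(u, v), (v, u)}) u x)"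
    by (rule sum_rooted_count_join[OF join.hyps, symmetric])
  finally show ?case .
qed

end

text \<open>The assumption on end vertices for \<open>t = q + 1\<close>: the coloring of the path
  becomes a walk with \<open>q\<close> edges, and the comparison at \<open>s = 2\<close> becomes one
  of degrees.\<close>

locale strict_ranked_target = ranked_target +
  assumes unequal_ends: "0 < q \<Longrightarrow> \<exists>a\<in>V. \<exists>b\<in>V. deg a < deg b \<and> 0 < walks q a b"
begin

lemma merge_path_weights_strict:
  assumes "strict_weight \<phi>" "0 < p" "0 < q"
  shows "(\<Sum>x\<in>V. \<phi> x * path_weight (p + q) x) < (\<Sum>x\<in>V. \<phi> x * path_weight q x * path_weight p x)"
proof -
  obtain a b where "a \<in> V" "b \<in> V" "deg a < deg b" "0 < walks q a b"
    using unequal_ends assms(3) by blast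
  then show ?thesis
    using merge_paths_strict[OF assms(1) strict_weight_path_weight[OF assms(2)], of a b q]
    by (simp add: path_weight_add mult_ac)
qed

text \<open>A path with an inner root is included, which a constant \<phi> could not tell from a
  path rooted at its end. If \<open>A\<close> has an edge, folding the path at the root is already
  strict; if \<open>A\<close> is one vertex, the failure to be a rooted path lies in
  \<open>B\<close>.\<close>

lemma path_weight_less_rooted_count:
  assumes "rooted_tree A E u" "strict_weight \<phi>" "\<not> rooted_path A E u"
  shows "(\<Sum>x\<in>V. \<phi> x * path_weight (card A - 1) x) < (\<Sum>x\<in>V. \<phi> x * rooted_count A E u x)"
  using assms
proof (induction arbitrary: \<phi> rule: rooted_tree.induct)
  case (single u)
  then show ?case
    using rooted_path.single[of u] by simp
next
  case (join A E u B F v)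
  note pos = card_rooted_tree_pos[OF join.hyps(1)] card_rooted_tree_pos[OF join.hyps(2)]
  note card = card_rooted_tree_join[OF join.hyps]
  have w: "weight \<phi>"
    using join.prems by (simp add: strict_weight_def)
  let ?\<phi>A = "\<lambda>x. \<phi> x * rooted_count A E u x"
  have wA: "weight ?\<phi>A"
    using w weight_rooted_count[OF join.hyps(1)] by (rule weight_mult)
  have B_le: "(\<Sum>x\<in>V. nsum ?\<phi>A x * path_weight (card B - 1) x) \<le>
      (\<Sum>x\<in>V. nsum ?\<phi>A x * rooted_count B F v x)"
    using wA by (intro path_weight_le_rooted_count join.hyps rank_mono_nsum) (simp add: weight_def)
  have wB: "weight (\<lambda>x. \<phi> x * path_weight (card B) x)"
    using w weight_path_weight by (rule weight_mult)
  have A_le: "(\<Sum>x\<in>V. \<phi> x * path_weight (card B) x * path_weight (card A - 1) x) \<le>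
      (\<Sum>x\<in>V. nsum ?\<phi>A x * path_weight (card B - 1) x)"
    unfolding sum_nsum_path_weight
    using path_weight_le_rooted_count[OF join.hyps(1)] wB pos by (simp add: weight_def)
  have merge: "(\<Sum>x\<in>V. \<phi> x * path_weight (card (A \<union> B) - 1) x) \<le>
      (\<Sum>x\<in>V. \<phi> x * path_weight (card B) x * path_weight (card A - 1) x)"
    unfolding card using w by (intro merge_path_weights) (simp add: weight_def)
  have "(\<Sum>x\<in>V. \<phi> x * path_weight (card (A \<union> B) - 1) x) < (\<Sum>x\<in>V. nsum ?\<phi>A x * rooted_count B F v x)"
  proof (cases "card A = 1")
    case True
    then have A: "A = {u}"
      using rooted_treeD(2)[OF join.hyps(1)] by (auto simp: card_1_singleton_iff)
    have E: "E = {}"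
      using join.hyps(1)
    proof cases
      case (join A1 E1 B1 F1 v1)
      then show ?thesis
        using rooted_treeD(2)[OF join(3)] rooted_treeD(2)[OF join(4)] A by auto
    qed
    have "\<not> rooted_path B F v"
      using join.prems(2) join.hyps(3) rooted_path.extend[of B F v u] by (auto simp: A E)
    then have "(\<Sum>x\<in>V. nsum ?\<phi>A x * path_weight (card B - 1) x) <
        (\<Sum>x\<in>V. nsum ?\<phi>A x * rooted_count B F v x)"
      by (intro join.IH(2) strict_weight_nsum wA)
    then show ?thesis
      using merge A_le by linarith
  next
    case False
    \<comment> \<open>Both pieces have an edge, as \<open>card A - 1\<close> and
      \<open>card B\<close> are positive.\<close>
    then have "(\<Sum>x\<in>V. \<phi> x * path_weight (card (A \<union> B) - 1) x) <
        (\<Sum>x\<in>V. \<phi> x * path_weight (card B) x * path_weight (card A - 1) x)"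
      unfolding card using join.prems(1) pos by (intro merge_path_weights_strict) auto
    then show ?thesis
      using A_le B_le by linarith
  qed
  then show ?case
    unfolding sum_rooted_count_join[OF join.hyps] .
qed

lemma num_colorings_path_graph:
  assumes "0 < n"
  shows "num_colorings (path_graph n) H = (\<Sum>x\<in>V. path_weight (n - 1) x)"
proof -
  have "path_graph n = \<lparr>pverts = {1..n}, parcs = parcs (path_graph n)\<rparr>"
    by (simp add: path_graph_def)
  then show ?thesis
    using num_colorings_eq_sum[of "{1..n}" n "parcs (path_graph n)"]
      rooted_count_path[OF rooted_path_path_graph[OF assms]] assms
    by simp
qed

text \<open>The tree is split at an edge: as each side serves as the weight for the other one, it
  suffices that one of the sides is not a path rooted at an end.\<close>

lemma strongly_Hoffman_London: "strongly_Hoffman_London H"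
  unfolding strongly_Hoffman_London_def
proof (intro allI impI, elim conjE)
  fix n :: nat and T :: "nat pair_pre_digraph"
  assume T: "graph_tree T" and n: "1 \<le> n" "card (pverts T) = n"
    and not_path: "\<not> digraph_iso (with_proj T) (with_proj (path_graph n))"
  interpret T: pair_graph T
    using T by (simp add: graph_tree_def)
  have no_path: "\<not> rooted_path (pverts T) (parcs T) w" for w
    using rooted_path_digraph_iso[OF T.pair_wf_digraph] not_path n by auto
  obtain u where "u \<in> pverts T"
    using n by fastforce
  then have "rooted_tree (pverts T) (parcs T) u"
    by (rule graph_tree_imp_rooted_tree[OF T])
  then show "num_colorings (path_graph n) H < num_colorings T H"
  proof cases
    case single
    then show ?thesis
      using no_path rooted_path.single by metis
  next
    case (join A E B F v)
    note join = this
    note pos = card_rooted_tree_pos[OF join(3)] card_rooted_tree_pos[OF join(4)]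
    have card: "n - 1 = (card A - 1) + card B"
      using card_rooted_tree_join[OF join(3-5)] join(1) n by simp
    let ?A = "rooted_count A E u" and ?B = "rooted_count B F v"
    have wA: "weight ?A"
      by (rule weight_rooted_count[OF join(3)])
    have sA: "strict_weight (nsum ?A)"
      by (rule strict_weight_nsum[OF wA])
    have sB: "strict_weight (path_weight (card B))"
      by (rule strict_weight_path_weight[OF pos(2)])
    have "T = \<lparr>pverts = A \<union> B, parcs = E \<union> F \<union> {(u, v), (v, u)}\<rparr>"
      using join(1,2) by (cases T) simp
    then have "num_colorings T H =
        (\<Sum>x\<in>V. 1 * rooted_count (A \<union> B) (E \<union> F \<union> {(u, v), (v, u)}) u x)"
      using num_colorings_eq_sum[of "A \<union> B" u] rooted_treeD[OF join(3)] rooted_treeD[OF join(4)] by simp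
    also have "\<dots> = (\<Sum>x\<in>V. nsum ?A x * ?B x)"
      unfolding sum_rooted_count_join[OF join(3-5)] by simp
    finally have T_eq: "num_colorings T H = (\<Sum>x\<in>V. nsum ?A x * ?B x)" .
    have P_le: "num_colorings (path_graph n) H \<le> (\<Sum>x\<in>V. path_weight (card B) x * path_weight (card A - 1) x)"
      using merge_path_weights[of "\<lambda>_. 1" "card A - 1" "card B"] weight_one num_colorings_path_graph[of n] n
      unfolding card by (simp add: weight_def)
    \<comment> \<open>One side at a time: \<open>A\<close> is compared while a path still stands for
      \<open>B\<close>, then \<open>B\<close> is compared with the true \<open>A\<close> as
      weight.\<close>
    have A_le: "(\<Sum>x\<in>V. path_weight (card B) x * path_weight (card A - 1) x) \<le>
        (\<Sum>x\<in>V. path_weight (card B) x * ?A x)"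
      using sB by (intro path_weight_le_rooted_count join) (simp add: strict_weight_def weight_def)
    have B_le: "(\<Sum>x\<in>V. nsum ?A x * path_weight (card B - 1) x) \<le> (\<Sum>x\<in>V. nsum ?A x * ?B x)"
      using sA by (intro path_weight_le_rooted_count join) (simp add: strict_weight_def weight_def)
    have mid: "(\<Sum>x\<in>V. nsum ?A x * path_weight (card B - 1) x) = (\<Sum>x\<in>V. path_weight (card B) x * ?A x)"
      using sum_nsum_path_weight[of "\<lambda>_. 1" ?A "card B - 1"] pos by simp
    show ?thesis
    proof (cases "rooted_path A E u")
      case True
      \<comment> \<open>Paths rooted at \<open>u\<close> and at \<open>v\<close> would join to a
        path on all of \<open>T\<close>.\<close>
      then have "\<not> rooted_path B F v"
        using rooted_path_join[OF True] join(1,2,5) no_path by metis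
      then show ?thesis
        using path_weight_less_rooted_count[OF join(4) sA] P_le A_le mid T_eq by linarith
    next
      case False
      then show ?thesis
        using path_weight_less_rooted_count[OF join(3) sB] P_le B_le mid T_eq by linarith
    qed
  qed
qed

end

section \<open>The order given by the similarity classes\<close>

lemma similarity_rank_exists:
  assumes H: "pair_wf_digraph H" and C: "bij_betw C {1..k} (similarity_classes H)"
  obtains rank where "\<And>x. x \<in> pverts H \<Longrightarrow> rank x \<in> {1..k}"
    "\<And>x i. x \<in> pverts H \<Longrightarrow> i \<in> {1..k} \<Longrightarrow> x \<in> C i \<longleftrightarrow> rank x = i"
proof -
  note eq = equiv_automorphically_similar[OF H]
  have ex: "\<exists>i\<in>{1..k}. x \<in> C i" if "x \<in> pverts H" for x
  proof -
    have "x \<in> \<Union>(C ` {1..k})"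
      using that Union_quotient[OF eq] C by (simp add: bij_betw_def similarity_classes_def)
    then show ?thesis
      by blast
  qed
  have unique: "i = j" if "i \<in> {1..k}" "j \<in> {1..k}" "x \<in> C i" "x \<in> C j" for i j x
  proof -
    have "C i \<in> similarity_classes H" "C j \<in> similarity_classes H"
      using C that by (auto simp: bij_betw_def)
    then have "C i = C j"
      using quotient_disj[OF eq] that unfolding similarity_classes_def by blast
    then show ?thesis
      using C that by (auto simp: bij_betw_def dest: inj_onD)
  qed
  obtain rank where rank: "\<And>x. x \<in> pverts H \<Longrightarrow> rank x \<in> {1..k} \<and> x \<in> C (rank x)"
    using ex by metis
  show ?thesis
    by (rule that[of rank]) (use rank unique in \<open>blast+\<close>)
qed

lemma card_upper_neighbours:
  assumes H: "pair_pseudo_graph H" and C: "bij_betw C {1..k} (similarity_classes H)"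
    and rank: "\<And>x. x \<in> pverts H \<Longrightarrow> rank x \<in> {1..k}"
      "\<And>x i. x \<in> pverts H \<Longrightarrow> i \<in> {1..k} \<Longrightarrow> x \<in> C i \<longleftrightarrow> rank x = i"
    and x: "x \<in> pverts H" and c: "1 \<le> c"
  shows "card {w \<in> pverts H. (x, w) \<in> parcs H \<and> c \<le> rank w} =
    (\<Sum>j=c..k. similarity_matrix H C (rank x) j)"
proof -
  interpret pair_pseudo_graph H by fact
  have wf: "pair_wf_digraph H" ..
  have C_in: "C i \<in> similarity_classes H" if "i \<in> {1..k}" for i
    using C that by (auto simp: bij_betw_def)
  have C_eq: "C i = {w \<in> pverts H. rank w = i}" if "i \<in> {1..k}" for i
    using rank(2)[OF _ that] similarity_class_subset[OF wf C_in[OF that]] by blast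
  have m: "similarity_matrix H C (rank x) j = card {w \<in> C j. (x, w) \<in> parcs H}" if "j \<in> {1..k}" for j
    using rank x C_in that by (intro similarity_matrix_eq[OF wf]) auto
  have "{w \<in> pverts H. (x, w) \<in> parcs H \<and> c \<le> rank w} = (\<Union>j\<in>{c..k}. {w \<in> C j. (x, w) \<in> parcs H})"
    using rank(1) C_eq c by auto
  also have "card \<dots> = (\<Sum>j=c..k. card {w \<in> C j. (x, w) \<in> parcs H})"
    using C_eq c pair_finite_verts by (intro card_UN_disjoint) auto
  also have "\<dots> = (\<Sum>j=c..k. similarity_matrix H C (rank x) j)"
    using m c by (intro sum.cong) auto
  finally show ?thesis .
qed

lemma increasing_columns_mono:
  assumes "increasing_columns k m" "1 \<le> c" "1 \<le> i" "i \<le> i'" "i' \<le> k"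
  shows "(\<Sum>j=c..k. m i j) \<le> (\<Sum>j=c..k. m i' j)"
  using assms(4,5)
proof (induction i' rule: dec_induct)
  case (step i')
  have "(\<Sum>j=c..k. m i' j) \<le> (\<Sum>j=c..k. m (i' + 1) j)"
  \<comment> \<open>For \<open>c > k\<close> the property says nothing, but both sums are
    empty.\<close>
  proof (cases "c \<le> k")
    case True
    then show ?thesis
      using assms(1-3) step.hyps step.prems by (auto simp: increasing_columns_def)
  qed simp
  then show ?case
    using step by simp
qed simp

text \<open>Once an end of the edge has color \<open>x\<close>, the other end can take any neighbor
  of \<open>x\<close>. This turns the hypothesis at \<open>s = 2\<close> into one on
  degrees.\<close>

lemma (in ranked_target) num_colorings_to_class_edge:
  assumes "X \<in> similarity_classes H" "x \<in> X"
  shows "num_colorings_to_class (path_graph 2) 1 H X = deg x"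
proof -
  have wf: "pair_wf_digraph H" ..
  have x: "x \<in> V"
    using similarity_class_subset[OF wf] assms by blast
  have P2: "path_graph 2 = \<lparr>pverts = insert 1 {2}, parcs = {} \<union> {(1, 2), (2, 1)}\<rparr>"
    by (auto simp: path_graph_def)
  have "rooted_path (insert 1 {2}) ({} \<union> {(1, 2), (2, 1)}) (1 :: nat)"
    by (intro rooted_path.intros) simp
  from rooted_count_path[OF this x]
  have "rooted_count (insert 1 {2}) ({} \<union> {(1, 2), (2, 1)}) (1 :: nat) x = deg x"
    by (simp add: path_weight_def deg_def)
  moreover have "num_colorings_to_class (path_graph 2) 1 H X = card {f \<in> colorings (path_graph 2) H. f 1 = x}"
    using assms by (intro num_colorings_to_class_eq wf) (unfold_locales, auto simp: path_graph_def)
  ultimately show ?thesis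
    unfolding rooted_count_def P2 by simp
qed

theorem corollary1p6:
  fixes H :: "'a pair_pre_digraph" and C :: "nat \<Rightarrow> 'a set" and k :: nat
  assumes "pair_pseudo_graph H"
    and "bij_betw C {1..k} (similarity_classes H)"
    and "increasing_columns k (similarity_matrix H C)"
    and "\<forall>t\<ge>2. \<exists>a\<in>{1..k}. \<exists>b\<in>{1..k}.
           (\<exists>f\<in>colorings (path_graph t) H. f 1 \<in> C a \<and> f t \<in> C b) \<and>
           (\<forall>s\<ge>2. num_colorings_to_class (path_graph s) 1 H (C b) >
                   num_colorings_to_class (path_graph s) 1 H (C a))"
  shows "strongly_Hoffman_London H"
proof -
  interpret pair_pseudo_graph H by fact
  have wf: "pair_wf_digraph H" ..
  obtain rank where rank: "\<And>x. x \<in> pverts H \<Longrightarrow> rank x \<in> {1..k}"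
    "\<And>x i. x \<in> pverts H \<Longrightarrow> i \<in> {1..k} \<Longrightarrow> x \<in> C i \<longleftrightarrow> rank x = i"
    using similarity_rank_exists[OF wf assms(2)] by blast
  interpret ranked_target H rank
  proof
    fix x y c assume xy: "x \<in> pverts H" "y \<in> pverts H" "rank x \<le> rank y"
    \<comment> \<open>Ranks start at 1, so the threshold 0 acts as 1; the increasing columns
      property is stated for \<open>c \<ge> 1\<close>.\<close>
    have "{w \<in> pverts H. (z, w) \<in> parcs H \<and> c \<le> rank w} =
        {w \<in> pverts H. (z, w) \<in> parcs H \<and> max 1 c \<le> rank w}" for z
      using rank(1) by auto
    then show "card {w \<in> pverts H. (x, w) \<in> parcs H \<and> c \<le> rank w} \<le>
        card {w \<in> pverts H. (y, w) \<in> parcs H \<and> c \<le> rank w}"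
      using xy rank(1) card_upper_neighbours[OF assms(1,2) rank, of _ "max 1 c"]
        increasing_columns_mono[OF assms(3), of "max 1 c" "rank x" "rank y"]
      by simp
  qed
  interpret strict_ranked_target H rank
  proof
    fix q :: nat assume "0 < q"
    then have t: "2 \<le> Suc q"
      by simp
    then obtain a b f where ab: "a \<in> {1..k}" "b \<in> {1..k}"
      and f: "f \<in> colorings (path_graph (Suc q)) H" "f 1 \<in> C a" "f (Suc q) \<in> C b"
      and less: "\<forall>s\<ge>2. num_colorings_to_class (path_graph s) 1 H (C b) >
                   num_colorings_to_class (path_graph s) 1 H (C a)"
      using assms(4) by blast
    have "C a \<in> similarity_classes H" "C b \<in> similarity_classes H"
      using assms(2) ab by (auto simp: bij_betw_def)
    then have "deg (f 1) < deg (f (Suc q))"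
      using less[rule_format, of 2] f num_colorings_to_class_edge by simp
    moreover have verts: "f (Suc i) \<in> pverts H" if "i \<le> q" for i
      using f(1) that by (auto simp: colorings_def path_graph_def)
    moreover have "0 < walks q (f (Suc 0)) (f (Suc q))"
    \<comment> \<open>The path is numbered from 1, so the \<open>i\<close>-th vertex of the walk is
      \<open>f (Suc i)\<close>.\<close>
    proof (rule walks_pos)
      show "(f (Suc i), f (Suc (Suc i))) \<in> parcs H" if "i < q" for i
        using f(1) that by (auto simp: colorings_def path_graph_def)
    qed (rule verts)
    ultimately show "\<exists>a\<in>pverts H. \<exists>b\<in>pverts H. deg a < deg b \<and> 0 < walks q a b"
      using verts[of 0] verts[of q] by (intro bexI[of _ "f 1"] bexI[of _ "f (Suc q)"]) auto
  qed
  show ?thesis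
    by (rule strongly_Hoffman_London)
qed

end
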